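(* For integers $m\ge1$ and $i\ge 0$ define $\mathbf{H}_{(m)}^{q(i)}=\sum_{\beta\models m} q^{(\ell(\beta)-1)i+n(\overleftarrow{\beta})}\,\mathbf{s}_\beta$. For a composition $\alpha=(\alpha_1,\dots,\alpha_k)$ with $k=\ell(\alpha)$, $$\mathbf{H}_\alpha^{q1}=\mathbf{H}_{(\alpha_1)}^{q(\sum_{i>1}\alpha_i)}\,\mathbf{H}_{(\alpha_2)}^{q(\sum_{i>2}\alpha_i)}\cdots\mathbf{H}_{(\alpha_k)}^{q(0)},$$ where $\mathbf{H}_\alpha^{q1}$ is the specialization at $t=1$ of $\mathbf{H}_\alpha^{qt}=\sum_{\beta\models|\alpha|}t^{c(\alpha,\beta^c)}q^{c(\alpha',\overleftarrow{\beta})}\,\mathbf{s}_\beta$.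
   Context: A composition $\alpha$ of a positive integer $n$ ($\alpha\models n$) is a sequence $(\alpha_1,\dots,\alpha_\ell)$ of positive integers with sum $n$; $|\alpha|=n$, $\ell(\alpha)=\ell$. The descent set is $D(\alpha)=\{\alpha_1,\alpha_1+\alpha_2,\dots,\alpha_1+\cdots+\alpha_{\ell-1}\}\subseteq\{1,\dots,n-1\}$; $\alpha\mapsto D(\alpha)$ is a bijection onto subsets of $\{1,\dots,n-1\}$. For compositions of the same $n$, $\alpha\le\beta$ (equivalently $\beta\ge\alpha$) means $D(\beta)\subseteq D(\alpha)$. Involutions: $\overleftarrow{\alpha}=(\alpha_\ell,\dots,\alpha_1)$; $\alpha^c$ is the composition of $n$ with $D(\alpha^c)=\{1,\dots,n-1\}\setminus D(\alpha)$; $\alpha'=\overleftarrow{\alpha^c}$. Statistics: $n(\alpha)=\sum_{i\in D(\alpha)}i$, and for $\alpha,\beta\models n$, $c(\alpha,\beta)=\sum_{i\in D(\alpha)\cap D(\beta)} i$. $NC\Lambda$ is the free associative algebra on $\mathbf{h}_1,\mathbf{h}_2,\dots$ over $\mathbb{Q}$, with coefficients extended to $\mathbb{Q}(q,t)$. Put $\mathbf{h}_\alpha=\mathbf{h}_{\alpha_1}\cdots\mathbf{h}_{\alpha_\ell}$. The ribbon Schur functions are $\mathbf{s}_\alpha=\sum_{\beta\ge\alpha}(-1)^{\ell(\alpha)-\ell(\beta)}\mathbf{h}_\beta$. *)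

theory Defs
  imports
    "HOL-Library.Poly_Mapping"
    "HOL-Computational_Algebra.Computational_Algebra"
    "HOL-Computational_Algebra.Field_as_Ring"
begin

section \<open>Compositions\<close>

text \<open>The type contains the empty composition (of 0). Concatenation is written additively,
  so that compositions are exactly the words in the letters 1, 2, \<dots> and form the free monoid
  required as exponents by \<^type>\<open>poly_mapping\<close>.\<close>

typedef composition = "{xs :: nat list. \<forall>x\<in>set xs. 0 < x}"
  morphisms parts Comp
  by (rule exI[of _ "[]"]) simp

setup_lifting type_definition_composition

instantiation composition :: monoid_add
begin

lift_definition zero_composition :: composition is "[]"
  by simp

lift_definition plus_composition :: "composition \<Rightarrow> composition \<Rightarrow> composition" is "(@)"
  by auto

instance
  by standard (transfer, simp)+

end

definition weight :: "composition \<Rightarrow> nat" where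
  "weight \<alpha> = sum_list (parts \<alpha>)"

definition len :: "composition \<Rightarrow> nat" where
  "len \<alpha> = length (parts \<alpha>)"

definition descents :: "composition \<Rightarrow> nat set" where
  "descents \<alpha> = {sum_list (take i (parts \<alpha>)) | i. 1 \<le> i \<and> i < len \<alpha>}"

definition compositions :: "nat \<Rightarrow> composition set" where
  "compositions n = {\<alpha>. weight \<alpha> = n}"

definition finer_eq :: "composition \<Rightarrow> composition \<Rightarrow> bool" where
  "finer_eq \<alpha> \<beta> \<longleftrightarrow> weight \<alpha> = weight \<beta> \<and> descents \<beta> \<subseteq> descents \<alpha>"

lift_definition reverse :: "composition \<Rightarrow> composition" is rev
  by simp

definition complement :: "composition \<Rightarrow> composition" where
  "complement \<alpha> = (THE \<beta>. weight \<beta> = weight \<alpha> \<and> descents \<beta> = {1..<weight \<alpha>} - descents \<alpha>)"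

definition conjugate :: "composition \<Rightarrow> composition" where
  "conjugate \<alpha> = reverse (complement \<alpha>)"

definition n_stat :: "composition \<Rightarrow> nat" where
  "n_stat \<alpha> = \<Sum>(descents \<alpha>)"

definition c_stat :: "composition \<Rightarrow> composition \<Rightarrow> nat" where
  "c_stat \<alpha> \<beta> = \<Sum>(descents \<alpha> \<inter> descents \<beta>)"


subsection \<open>The complement is well defined\<close>

definition psums :: "nat list \<Rightarrow> nat set" where
  "psums xs = {sum_list (take i xs) | i. 1 \<le> i \<and> i < length xs}"

lemma psums_Nil: "psums [] = {}" and psums_single: "psums [x] = {}"
  by (auto simp: psums_def)

lemma psums_snoc:
  assumes "xs \<noteq> []"
  shows "psums (xs @ [x]) = insert (sum_list xs) (psums xs)"
proof (intro equalityI subsetI)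
  fix s assume "s \<in> psums (xs @ [x])"
  then obtain i where i: "1 \<le> i" "i \<le> length xs" "s = sum_list (take i xs)"
    by (auto simp: psums_def)
  show "s \<in> insert (sum_list xs) (psums xs)"
    using i by (cases "i = length xs") (auto simp: psums_def)
next
  fix s assume "s \<in> insert (sum_list xs) (psums xs)"
  moreover have "sum_list xs \<in> psums (xs @ [x])"
    using assms unfolding psums_def
    by (intro CollectI exI[of _ "length xs"]) (auto simp: Suc_le_eq)
  moreover have "psums xs \<subseteq> psums (xs @ [x])"
    by (force simp: psums_def)
  ultimately show "s \<in> psums (xs @ [x])" by blast
qed

lemma psums_less:
  assumes "\<forall>x\<in>set xs. 0 < x"
  shows "psums xs \<subseteq> {1..<sum_list xs}"
  using assms
proof (induction xs rule: rev_induct)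
  case (snoc x xs)
  show ?case
  proof (cases "xs = []")
    case False
    then have "0 < sum_list xs" using snoc.prems by (cases xs) auto
    then show ?thesis using False snoc by (auto simp: psums_snoc)
  qed (simp add: psums_single)
qed (simp add: psums_Nil)

lemma psums_inj:
  assumes "\<forall>x\<in>set xs. 0 < x" "\<forall>x\<in>set ys. 0 < x"
    and "sum_list xs = sum_list ys" "psums xs = psums ys"
  shows "xs = ys"
  using assms
proof (induction xs arbitrary: ys rule: rev_induct)
  case Nil
  then show ?case by (cases ys) auto
next
  case (snoc x xs)
  then obtain y zs where ys: "ys = zs @ [y]"
    by (cases ys rule: rev_cases) auto
  have max: "Max (psums (us @ [u])) = sum_list us \<and> psums us = psums (us @ [u]) - {sum_list us}"
    if "us \<noteq> []" "\<forall>x\<in>set us. 0 < x" for us :: "nat list" and u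
  proof -
    have *: "psums us \<subseteq> {1..<sum_list us}" using psums_less that by blast
    then have "finite (psums us)" by (rule finite_subset) simp
    then have "Max (insert (sum_list us) (psums us)) = sum_list us"
      using * by (intro Max_eqI) (auto dest: less_imp_le)
    then show ?thesis using that * by (auto simp: psums_snoc)
  qed
  have empty: "us = [] \<longleftrightarrow> psums (us @ [u]) = {}" for us :: "nat list" and u
    by (cases "us = []") (auto simp: psums_snoc psums_single)
  show ?case
  proof (cases "xs = []")
    case True
    then have "zs = []" using empty[of xs x] empty[of zs y] snoc.prems ys by simp
    then show ?thesis using True snoc.prems ys by simp
  next
    case False
    then have "zs \<noteq> []" using empty[of xs x] empty[of zs y] snoc.prems ys by simp
    then have *: "sum_list xs = sum_list zs" "psums xs = psums zs"
      using max[of xs x] max[of zs y] False snoc.prems ys by auto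
    then have "xs = zs" using snoc.IH[of zs] snoc.prems ys by auto
    then show ?thesis using * snoc.prems ys by simp
  qed
qed

lemma psums_surj:
  assumes "S \<subseteq> {1..<n}"
  shows "\<exists>xs. (\<forall>x\<in>set xs. 0 < x) \<and> sum_list xs = n \<and> psums xs = S"
  using assms
proof (induction n arbitrary: S rule: less_induct)
  case (less n)
  have fin: "finite S" using less.prems by (rule finite_subset) simp
  show ?case
  proof (cases "S = {}")
    case True
    show ?thesis
    proof (cases "n = 0")
      case True
      with \<open>S = {}\<close> show ?thesis by (intro exI[of _ "[]"]) (simp add: psums_Nil)
    next
      case False
      with \<open>S = {}\<close> show ?thesis by (intro exI[of _ "[n]"]) (simp add: psums_single)
    qed
  next
    case False
    define k where "k = Max S"
    have k: "k \<in> S" "1 \<le> k" "k < n" using Max_in[OF fin False] less.prems by (auto simp: k_def)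
    have "s < k" if "s \<in> S - {k}" for s
      using Max_ge[OF fin, of s] that by (auto simp: k_def intro: le_neq_trans)
    then have "S - {k} \<subseteq> {1..<k}" using less.prems by fastforce
    from less.IH[OF k(3) this] obtain xs where
      xs: "\<forall>x\<in>set xs. 0 < x" "sum_list xs = k" "psums xs = S - {k}" by blast
    have "xs \<noteq> []" using xs k by auto
    then show ?thesis using xs k
      by (intro exI[of _ "xs @ [n - k]"]) (auto simp: psums_snoc)
  qed
qed

lemma descents_bij:
  "bij_betw descents (compositions n) (Pow {1..<n})"
proof -
  have d: "descents \<alpha> = psums (parts \<alpha>)" for \<alpha>
    by (simp add: descents_def psums_def len_def)
  have p: "\<forall>x\<in>set (parts \<alpha>). 0 < x" for \<alpha>
    using parts[of \<alpha>] by simp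
  show ?thesis
  proof (rule bij_betwI')
    fix \<alpha> \<beta> assume "\<alpha> \<in> compositions n" "\<beta> \<in> compositions n"
    then show "(descents \<alpha> = descents \<beta>) = (\<alpha> = \<beta>)"
      using psums_inj[OF p p, of \<alpha> \<beta>] by (auto simp: compositions_def weight_def d parts_inject)
  next
    fix \<alpha> assume "\<alpha> \<in> compositions n"
    then show "descents \<alpha> \<in> Pow {1..<n}"
      using psums_less[OF p, of \<alpha>] by (simp add: compositions_def weight_def d)
  next
    fix S assume "S \<in> Pow {1..<n}"
    then obtain xs where xs: "\<forall>x\<in>set xs. 0 < x" "sum_list xs = n" "psums xs = S"
      using psums_surj[of S n] by auto
    then have "parts (Comp xs) = xs" by (simp add: Comp_inverse)
    with xs show "\<exists>\<alpha>\<in>compositions n. S = descents \<alpha>"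
      by (intro bexI[of _ "Comp xs"]) (auto simp: compositions_def weight_def d)
  qed
qed

lemma complement:
  "weight (complement \<alpha>) = weight \<alpha>"
  "descents (complement \<alpha>) = {1..<weight \<alpha>} - descents \<alpha>"
proof -
  let ?S = "{1..<weight \<alpha>} - descents \<alpha>"
  have "?S \<in> descents ` compositions (weight \<alpha>)"
    using descents_bij[of "weight \<alpha>"] by (simp add: bij_betw_def)
  then obtain \<beta> where "\<beta> \<in> compositions (weight \<alpha>)" "descents \<beta> = ?S" by force
  moreover have "inj_on descents (compositions (weight \<alpha>))"
    using descents_bij by (rule bij_betw_imp_inj_on)
  ultimately have "\<exists>!\<beta>. weight \<beta> = weight \<alpha> \<and> descents \<beta> = ?S"
    by (intro ex1I[of _ \<beta>]) (auto simp: compositions_def inj_on_def)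
  from theI'[OF this] show "weight (complement \<alpha>) = weight \<alpha>"
    "descents (complement \<alpha>) = {1..<weight \<alpha>} - descents \<alpha>"
    unfolding complement_def by blast+
qed


section \<open>Coefficients and the specialization at t = 1\<close>

text \<open>The field of fractions of Q[q][t]: the outer polynomial variable is t, the inner one q.\<close>

type_synonym ratfun = "rat poly poly fract"

definition q_var :: ratfun where
  "q_var = to_fract [:[:0, 1:]:]"

definition t_var :: ratfun where
  "t_var = to_fract [:0, 1:]"

text \<open>Writing a rational function as a / b in lowest terms, it is defined at t = 1 iff b does not
  vanish there (see \<open>specialize_t1_Fract\<close>). Otherwise the value is 0, by the convention
  for denominator 0.\<close>

definition specialize_t1 :: "ratfun \<Rightarrow> ratfun" where
  "specialize_t1 x = (let (a, b) = quot_of_fract x in Fract [:poly a 1:] [:poly b 1:])"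

lemma specialize_t1_Fract:
  assumes "poly b 1 \<noteq> 0"
  shows "specialize_t1 (Fract a b) = Fract [:poly a 1:] [:poly b 1:]"
proof -
  obtain c d where cd: "quot_of_fract (Fract a b) = (c, d)" by fastforce
  have b: "b \<noteq> 0" using assms by auto
  have d: "d \<noteq> 0" and cop: "coprime c d"
    using quot_of_fract_in_normalized_fracts[of "Fract a b"] cd by (auto simp: normalized_fracts_def)
  have "Fract c d = Fract a b"
    using quot_to_fract_quot_of_fract[of "Fract a b"] cd by (simp add: quot_to_fract_def)
  then have eq: "c * b = a * d" using b d by (simp add: eq_fract)
  then have "d dvd c * b" by simp
  then have "d dvd b" using cop by (simp add: coprime_commute coprime_dvd_mult_right_iff)
  then have "poly d 1 \<noteq> 0" using assms by (auto elim!: dvdE)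
  moreover have "poly c 1 * poly b 1 = poly a 1 * poly d 1"
    using eq by (metis poly_mult)
  ultimately show ?thesis using assms by (simp add: specialize_t1_def cd eq_fract mult.commute)
qed

lemma specialize_t1_0 [simp]: "specialize_t1 0 = 0"
  by (simp add: specialize_t1_def fract_collapse)


section \<open>Noncommutative symmetric functions\<close>

text \<open>The free associative algebra on the letters 1, 2, \<dots> is the monoid algebra of compositions.\<close>

type_synonym ncsym = "composition \<Rightarrow>\<^sub>0 ratfun"

definition scale :: "ratfun \<Rightarrow> ncsym \<Rightarrow> ncsym" where
  "scale c = Poly_Mapping.map ((*) c)"

definition h_gen :: "nat \<Rightarrow> ncsym" where
  "h_gen k = Poly_Mapping.single (Comp [k]) 1"

definition h_fun :: "composition \<Rightarrow> ncsym" where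
  "h_fun \<alpha> = prod_list (map h_gen (parts \<alpha>))"

definition ribbon :: "composition \<Rightarrow> ncsym" where
  "ribbon \<alpha> = (\<Sum>\<beta> | finer_eq \<alpha> \<beta>. scale ((-1) ^ (len \<alpha> - len \<beta>)) (h_fun \<beta>))"

definition H_qt :: "composition \<Rightarrow> ncsym" where
  "H_qt \<alpha> = (\<Sum>\<beta>\<in>compositions (weight \<alpha>).
     scale (t_var ^ c_stat \<alpha> (complement \<beta>) * q_var ^ c_stat (conjugate \<alpha>) (reverse \<beta>)) (ribbon \<beta>))"

definition H_q1 :: "composition \<Rightarrow> ncsym" where
  "H_q1 \<alpha> = Poly_Mapping.map specialize_t1 (H_qt \<alpha>)"

definition H_row :: "nat \<Rightarrow> nat \<Rightarrow> ncsym" where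
  "H_row m i = (\<Sum>\<beta>\<in>compositions m.
     scale (q_var ^ ((len \<beta> - 1) * i + n_stat (reverse \<beta>))) (ribbon \<beta>))"

text \<open>Infinite index sets would make the sums above vanish silently.\<close>

lemma finite_compositions: "finite (compositions n)"
  using bij_betw_finite[OF descents_bij[of n]] by simp

lemma finite_finer_eq: "finite {\<beta>. finer_eq \<alpha> \<beta>}"
  by (rule finite_subset[OF _ finite_compositions[of "weight \<alpha>"]])
    (auto simp: finer_eq_def compositions_def)

end

(* At t = 1 the ribbon of beta has coefficient the product of w i over the descents i of beta,
   where w i = 1 if i is a descent of alpha and w i = q^(n-i) otherwise. Expanding ribbons in the
   h-basis, the coefficient of h_gamma becomes the product of w i over the descents i of gamma times
   the product of 1 - w i over the remaining positions. So only those gamma survive which descend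
   wherever alpha does, and the sum splits into one factor for each part of alpha. *)
theory Submission
  imports Defs
begin

section \<open>Descent sets\<close>

lemma parts_pos: "\<forall>x\<in>set (parts \<alpha>). 0 < x"
  using parts[of \<alpha>] by simp

lemma descents_eq_psums: "descents \<alpha> = psums (parts \<alpha>)"
  by (simp add: descents_def psums_def len_def)

lemma descents_subset: "descents \<alpha> \<subseteq> {1..<weight \<alpha>}"
  using psums_less[OF parts_pos] by (simp add: descents_eq_psums weight_def)

lemma finite_descents [simp]: "finite (descents \<alpha>)"
  using descents_subset by (rule finite_subset) simp

lemma composition_eqI:
  assumes "weight \<alpha> = weight \<beta>" "descents \<alpha> = descents \<beta>"
  shows "\<alpha> = \<beta>"
  using psums_inj[OF parts_pos parts_pos, of \<alpha> \<beta>] assms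
  by (simp add: descents_eq_psums weight_def parts_inject)

lemma composition_exists:
  assumes "S \<subseteq> {1..<n}"
  obtains \<alpha> where "weight \<alpha> = n" "descents \<alpha> = S"
proof -
  have "S \<in> descents ` compositions n"
    using descents_bij[of n] assms by (simp add: bij_betw_def)
  then show ?thesis using that by (auto simp: compositions_def)
qed

lemma compositions_0: "compositions 0 = {0}"
proof -
  have "\<alpha> = 0" if "weight \<alpha> = 0" for \<alpha>
  proof -
    have "parts \<alpha> = []" using that parts_pos[of \<alpha>] by (cases "parts \<alpha>") (auto simp: weight_def)
    then show ?thesis by (metis parts_inject zero_composition.rep_eq)
  qed
  moreover have "weight 0 = 0" by (simp add: weight_def zero_composition.rep_eq)
  ultimately show ?thesis by (auto simp: compositions_def)
qed

lemma card_psums: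
  assumes "\<forall>x\<in>set xs. 0 < x"
  shows "card (psums xs) = length xs - 1"
  using assms
proof (induction xs rule: rev_induct)
  case (snoc x xs)
  show ?case
  proof (cases "xs = []")
    case False
    have *: "psums xs \<subseteq> {1..<sum_list xs}" using psums_less snoc.prems by simp
    then have "finite (psums xs)" by (rule finite_subset) simp
    moreover have "sum_list xs \<notin> psums xs" using * by auto
    ultimately have "card (psums (xs @ [x])) = Suc (length xs - 1)"
      using False snoc by (simp add: psums_snoc)
    then show ?thesis using False by (cases xs) auto
  qed (simp add: psums_single)
qed (simp add: psums_Nil)

lemma card_descents: "card (descents \<alpha>) = len \<alpha> - 1"
  using card_psums[OF parts_pos] by (simp add: descents_eq_psums len_def)

text \<open>Turns the sign exponent of a ribbon into a count of descents, so that ribbon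
  coefficients can be summed over sets.\<close>

lemma len_diff_eq_card:
  assumes "finer_eq \<alpha> \<beta>"
  shows "len \<alpha> - len \<beta> = card (descents \<alpha> - descents \<beta>)"
\<comment> \<open>A nonempty composition has one part more than it has descents. The empty one
  breaks this rule, since subtraction truncates, and is handled apart.\<close>
proof (cases "weight \<alpha> = 0")
  case True
  then have "\<alpha> = 0" "\<beta> = 0" using assms compositions_0 by (auto simp: finer_eq_def compositions_def)
  then show ?thesis by simp
next
  case False
  then have "len \<alpha> \<noteq> 0" "len \<beta> \<noteq> 0" using assms by (auto simp: finer_eq_def weight_def len_def)
  moreover have "card (descents \<alpha> - descents \<beta>) = card (descents \<alpha>) - card (descents \<beta>)"
    using assms by (intro card_Diff_subset) (auto simp: finer_eq_def)
  ultimately show ?thesis by (simp add: card_descents)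
qed

section \<open>Descents of concatenations and reversals\<close>

lemma psums_Cons:
  assumes "xs \<noteq> []"
  shows "psums (x # xs) = insert x ((+) x ` psums xs)"
  using assms
proof (induction xs rule: rev_induct)
  case (snoc y ys)
  then show ?case
    using psums_snoc[of "x # ys" y] psums_snoc[of ys y] psums_snoc[of "[x]" y]
    by (cases "ys = []") (auto simp: psums_single)
qed simp

lemma psums_append:
  assumes "xs \<noteq> []" "ys \<noteq> []"
  shows "psums (xs @ ys) = psums xs \<union> insert (sum_list xs) ((+) (sum_list xs) ` psums ys)"
  using assms
proof (induction xs)
  case (Cons x xs)
  then show ?case
    by (cases "xs = []") (auto simp: psums_Cons psums_single image_image image_Un add.assoc)
qed simp

lemma weight_plus: "weight (\<alpha> + \<beta>) = weight \<alpha> + weight \<beta>"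
  by (simp add: weight_def plus_composition.rep_eq)

text \<open>The seam between the two words is itself a descent. This requires both words to be
  nonempty: concatenating with the empty word creates no seam.\<close>

lemma descents_plus:
  assumes "0 < weight \<alpha>" "0 < weight \<beta>"
  shows "descents (\<alpha> + \<beta>) =
    descents \<alpha> \<union> insert (weight \<alpha>) ((+) (weight \<alpha>) ` descents \<beta>)"
proof -
  have "parts \<alpha> \<noteq> []" "parts \<beta> \<noteq> []" using assms by (auto simp: weight_def)
  then show ?thesis
    by (simp add: descents_eq_psums weight_def plus_composition.rep_eq psums_append)
qed

text \<open>A partial sum of the reversed list is a suffix sum of the original one, hence the total
  minus a prefix sum.\<close>

lemma psums_rev: "psums (rev xs) = (\<lambda>s. sum_list xs - s) ` psums xs"
proof (induction xs rule: rev_induct)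
  case (snoc x xs)
  show ?case
  proof (cases "xs = []")
    case False
    have "psums (rev (xs @ [x])) = insert x ((\<lambda>s. x + (sum_list xs - s)) ` psums xs)"
      using False by (simp add: psums_Cons snoc.IH image_image)
    also have "(\<lambda>s. x + (sum_list xs - s)) ` psums xs = (\<lambda>s. sum_list (xs @ [x]) - s) ` psums xs"
    proof (rule image_cong)
      \<comment> \<open>A prefix sum is at most the total, so the truncated subtraction may be
        reassociated.\<close>
      fix s assume "s \<in> psums xs"
      then obtain i where "s = sum_list (take i xs)" by (auto simp: psums_def)
      moreover have "sum_list xs = sum_list (take i xs) + sum_list (drop i xs)"
        by (metis append_take_drop_id sum_list_append)
      ultimately show "x + (sum_list xs - s) = sum_list (xs @ [x]) - s" by simp
    qed simp
    finally show ?thesis using False by (simp add: psums_snoc)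
  qed (simp add: psums_single)
qed (simp add: psums_Nil)

lemma descents_reverse: "descents (reverse \<alpha>) = (\<lambda>s. weight \<alpha> - s) ` descents \<alpha>"
  by (simp add: descents_eq_psums weight_def reverse.rep_eq psums_rev)

lemma inj_on_reflect: "inj_on (\<lambda>s. n - s) {1..<n::nat}"
  by (auto simp: inj_on_def)

lemma n_stat_reverse: "n_stat (reverse \<alpha>) = (\<Sum>i\<in>descents \<alpha>. weight \<alpha> - i)"
proof -
  have "inj_on (\<lambda>s. weight \<alpha> - s) (descents \<alpha>)"
    using inj_on_reflect descents_subset by (rule inj_on_subset)
  then show ?thesis by (simp add: n_stat_def descents_reverse sum.reindex)
qed

text \<open>Conjugation and reversal reflect positions by the same map \<open>s\<close> to
  \<open>n - s\<close>. The common descents are therefore the reflections of those descents of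
  \<beta> that lie in the complement of the descents of \<alpha>.\<close>

lemma c_stat_conjugate_reverse:
  assumes "weight \<alpha> = weight \<beta>"
  shows "c_stat (conjugate \<alpha>) (reverse \<beta>) = (\<Sum>i\<in>descents \<beta> - descents \<alpha>. weight \<alpha> - i)"
proof -
  let ?f = "\<lambda>s. weight \<alpha> - s"
  have "descents (conjugate \<alpha>) \<inter> descents (reverse \<beta>) =
      ?f ` ({1..<weight \<alpha>} - descents \<alpha>) \<inter> ?f ` descents \<beta>"
    by (simp add: conjugate_def descents_reverse complement assms)
  also have "\<dots> = ?f ` (({1..<weight \<alpha>} - descents \<alpha>) \<inter> descents \<beta>)"
    using inj_on_image_Int[OF inj_on_reflect[of "weight \<alpha>"], of "{1..<weight \<alpha>} - descents \<alpha>" "descents \<beta>"]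
      descents_subset[of \<beta>] assms by simp
  also have "({1..<weight \<alpha>} - descents \<alpha>) \<inter> descents \<beta> = descents \<beta> - descents \<alpha>"
    using descents_subset[of \<beta>] assms by auto
  finally have "c_stat (conjugate \<alpha>) (reverse \<beta>) = \<Sum>(?f ` (descents \<beta> - descents \<alpha>))"
    by (simp add: c_stat_def)
  moreover have "inj_on ?f (descents \<beta> - descents \<alpha>)"
    using inj_on_reflect descents_subset[of \<beta>] assms by (auto intro: inj_on_subset)
  ultimately show ?thesis by (simp add: sum.reindex)
qed


section \<open>Weighted sums of ribbons\<close>

lemma lookup_scale: "Poly_Mapping.lookup (scale c p) \<gamma> = c * Poly_Mapping.lookup p \<gamma>"
  by (simp add: scale_def Poly_Mapping.map.rep_eq when_def)

text \<open>The products of generators are the basis vectors of the monoid algebra, so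
  \<open>lookup\<close> reads off coefficients in the h-basis.\<close>

lemma h_fun_eq_single: "h_fun \<alpha> = Poly_Mapping.single \<alpha> 1"
proof -
  have "prod_list (map h_gen xs) = Poly_Mapping.single (Comp xs) 1" if "\<forall>x\<in>set xs. 0 < x" for xs
    using that
  proof (induction xs)
    case Nil
    have "Comp [] = 0" by (simp add: zero_composition_def)
    then show ?case by simp
  next
    case (Cons x xs)
    have "Comp [x] + Comp xs = Comp (x # xs)"
      using Cons.prems by (simp add: plus_composition.abs_eq eq_onp_def)
    then show ?case using Cons by (simp add: h_gen_def mult_single)
  qed
  then show ?thesis using parts_pos by (simp add: h_fun_def parts_inverse)
qed

lemma lookup_ribbon:
  "Poly_Mapping.lookup (ribbon \<beta>) \<gamma> =
    (if finer_eq \<beta> \<gamma> then (- 1) ^ card (descents \<beta> - descents \<gamma>) else 0)"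
proof -
  have "Poly_Mapping.lookup (ribbon \<beta>) \<gamma> =
      (\<Sum>\<delta> | finer_eq \<beta> \<delta>. if \<delta> = \<gamma> then (- 1) ^ (len \<beta> - len \<gamma>) else 0)"
    unfolding ribbon_def lookup_sum
    by (intro sum.cong) (auto simp: lookup_scale h_fun_eq_single lookup_single)
  also have "\<dots> = (if finer_eq \<beta> \<gamma> then (- 1) ^ (len \<beta> - len \<gamma>) else 0)"
    by (simp add: finite_finer_eq)
  finally show ?thesis by (simp add: len_diff_eq_card)
qed

text \<open>The common shape of both sides: \<open>H_row\<close> and \<open>H_q1\<close> arise from
  suitable weights on positions, because their coefficients are multiplicative over
  descents.\<close>

definition ribbon_sum :: "nat \<Rightarrow> (nat \<Rightarrow> ratfun) \<Rightarrow> ncsym" where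
  "ribbon_sum n w = (\<Sum>\<beta>\<in>compositions n. scale (\<Prod>i\<in>descents \<beta>. w i) (ribbon \<beta>))"

lemma ribbon_sum_cong:
  assumes "\<And>i. 1 \<le> i \<Longrightarrow> i < n \<Longrightarrow> w i = v i"
  shows "ribbon_sum n w = ribbon_sum n v"
proof -
  have "(\<Prod>i\<in>descents \<beta>. w i) = (\<Prod>i\<in>descents \<beta>. v i)" if "\<beta> \<in> compositions n" for \<beta>
    using that descents_subset[of \<beta>] assms by (intro prod.cong) (auto simp: compositions_def)
  then show ?thesis by (simp add: ribbon_sum_def)
qed

text \<open>Expanding the product of the factors \<open>1 - w i\<close> gives a signed sum over
  subsets \<open>U\<close> of \<open>N - S\<close>. Putting \<open>T = S \<union> U\<close> turns it
  into a sum over the sets between \<open>S\<close> and \<open>N\<close>.\<close>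

lemma sum_supersets_alternating:
  fixes w :: "'a \<Rightarrow> 'b :: comm_ring_1"
  assumes "finite N" "S \<subseteq> N"
  shows "(\<Sum>T | S \<subseteq> T \<and> T \<subseteq> N. prod w T * (- 1) ^ card (T - S)) =
    prod w S * (\<Prod>i\<in>N - S. 1 - w i)"
proof -
  have "(\<Prod>i\<in>N - S. 1 - w i) = (\<Prod>i\<in>N - S. - w i + 1)"
    by simp
  also have "\<dots> = (\<Sum>U\<in>Pow (N - S). (- 1) ^ card U * prod w U)"
    using assms by (subst prod_add) (auto simp: prod_uminus)
  finally have "prod w S * (\<Prod>i\<in>N - S. 1 - w i) =
      (\<Sum>U\<in>Pow (N - S). prod w S * ((- 1) ^ card U * prod w U))"
    by (simp add: sum_distrib_left)
  also have "\<dots> = (\<Sum>T | S \<subseteq> T \<and> T \<subseteq> N. prod w T * (- 1) ^ card (T - S))"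
  proof (rule sum.reindex_bij_witness[of _ "\<lambda>T. T - S" "\<lambda>U. S \<union> U"])
    fix U assume U: "U \<in> Pow (N - S)"
    then have "prod w (S \<union> U) = prod w S * prod w U"
      using assms by (intro prod.union_disjoint) (auto intro: finite_subset)
    moreover have "S \<union> U - S = U" using U by auto
    ultimately show "prod w (S \<union> U) * (- 1) ^ card (S \<union> U - S) =
        prod w S * ((- 1) ^ card U * prod w U)" by (simp add: ac_simps)
  qed (use assms in auto)
  finally show ?thesis by simp
qed

text \<open>The coefficient of the basis element with descent set \<open>S\<close> in
  \<open>ribbon_sum n w\<close>. It vanishes as soon as \<open>w i = 1\<close> at some position
  \<open>i\<close> in \<open>{1..<n}\<close> outside \<open>S\<close>.\<close>

definition h_coeff :: "nat \<Rightarrow> (nat \<Rightarrow> ratfun) \<Rightarrow> nat set \<Rightarrow> ratfun" where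
  "h_coeff n w S = (\<Prod>i\<in>S. w i) * (\<Prod>i\<in>{1..<n} - S. 1 - w i)"

lemma lookup_sum_single:
  assumes "finite A"
  shows "Poly_Mapping.lookup (\<Sum>\<beta>\<in>A. Poly_Mapping.single \<beta> (c \<beta>)) \<gamma> = (if \<gamma> \<in> A then c \<gamma> else 0)"
  using assms by (simp add: lookup_sum lookup_single when_def)

text \<open>A basis element occurs in exactly the ribbons of the compositions finer than or equal to
  it. In terms of descent sets these are the supersets of its own, so its coefficient is an
  alternating sum over supersets.\<close>

lemma ribbon_sum_expand:
  "ribbon_sum n w = (\<Sum>\<gamma>\<in>compositions n. Poly_Mapping.single \<gamma> (h_coeff n w (descents \<gamma>)))"
proof (rule poly_mapping_eqI)
  fix \<gamma>
  have L: "Poly_Mapping.lookup (ribbon_sum n w) \<gamma> = (\<Sum>\<beta>\<in>compositions n. prod w (descents \<beta>) *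
      (if finer_eq \<beta> \<gamma> then (- 1) ^ card (descents \<beta> - descents \<gamma>) else 0))"
    by (simp add: ribbon_sum_def lookup_sum lookup_scale lookup_ribbon)
  show "Poly_Mapping.lookup (ribbon_sum n w) \<gamma> = Poly_Mapping.lookup
      (\<Sum>\<gamma>\<in>compositions n. Poly_Mapping.single \<gamma> (h_coeff n w (descents \<gamma>))) \<gamma>"
  proof (cases "\<gamma> \<in> compositions n")
    case True
    let ?S = "descents \<gamma>"
    have "Poly_Mapping.lookup (ribbon_sum n w) \<gamma> = (\<Sum>\<beta>\<in>compositions n. prod w (descents \<beta>) *
        (if ?S \<subseteq> descents \<beta> then (- 1) ^ card (descents \<beta> - ?S) else 0))"
      unfolding L using True by (intro sum.cong) (auto simp: finer_eq_def compositions_def)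
    also have "\<dots> = (\<Sum>T\<in>Pow {1..<n}. prod w T * (if ?S \<subseteq> T then (- 1) ^ card (T - ?S) else 0))"
      by (rule sum.reindex_bij_betw[OF descents_bij])
    also have "\<dots> = (\<Sum>T | ?S \<subseteq> T \<and> T \<subseteq> {1..<n}. prod w T * (- 1) ^ card (T - ?S))"
      by (rule sum.mono_neutral_cong_right) auto
    also have "\<dots> = h_coeff n w ?S"
      unfolding h_coeff_def using True descents_subset[of \<gamma>]
      by (intro sum_supersets_alternating) (auto simp: compositions_def)
    finally show ?thesis using True by (simp add: lookup_sum_single finite_compositions)
  next
    case False
    then have "Poly_Mapping.lookup (ribbon_sum n w) \<gamma> = 0"
      unfolding L by (intro sum.neutral) (auto simp: finer_eq_def compositions_def)
    then show ?thesis using False by (simp add: lookup_sum_single finite_compositions)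
  qed
qed

lemma ribbon_sum_0: "ribbon_sum 0 w = 1"
proof -
  have "descents 0 = {}" by (simp add: descents_eq_psums zero_composition.rep_eq psums_Nil)
  then show ?thesis by (simp add: ribbon_sum_expand compositions_0 h_coeff_def)
qed

section \<open>Cutting at a descent of weight one\<close>

lemma bij_betw_plus_compositions:
  assumes "0 < m" "0 < n"
  shows "bij_betw (\<lambda>(\<gamma>, \<delta>). \<gamma> + \<delta>) (compositions m \<times> compositions n)
    {\<beta> \<in> compositions (m + n). m \<in> descents \<beta>}"
proof (rule bij_betwI')
  fix p p' assume "p \<in> compositions m \<times> compositions n" "p' \<in> compositions m \<times> compositions n"
  then obtain \<gamma> \<delta> \<gamma>' \<delta>' where p: "p = (\<gamma>, \<delta>)" "p' = (\<gamma>', \<delta>')"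
    and w: "weight \<gamma> = m" "weight \<gamma>' = m" "weight \<delta> = n" "weight \<delta>' = n"
    by (auto simp: compositions_def)
  have "\<gamma> = \<gamma>' \<and> \<delta> = \<delta>'" if "\<gamma> + \<delta> = \<gamma>' + \<delta>'"
  proof -
    \<comment> \<open>Descents of the concatenation below \<open>m\<close> recover the left factor,
      and those above \<open>m\<close> recover the right one after a shift.\<close>
    have E: "descents \<gamma> \<union> insert m ((+) m ` descents \<delta>) =
        descents \<gamma>' \<union> insert m ((+) m ` descents \<delta>')"
      using descents_plus[of \<gamma> \<delta>] descents_plus[of \<gamma>' \<delta>'] that w assms by simp
    have left: "descents \<gamma> = (descents \<gamma> \<union> insert m ((+) m ` descents \<delta>)) \<inter> {..<m}"
      if "weight \<gamma> = m" for \<gamma> \<delta>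
      using descents_subset[of \<gamma>] that by auto
    have right: "(+) m ` descents \<delta> = (descents \<gamma> \<union> insert m ((+) m ` descents \<delta>)) \<inter> {m<..}"
      if "weight \<gamma> = m" for \<gamma> \<delta>
      using descents_subset[of \<gamma>] descents_subset[of \<delta>] that by fastforce
    have "descents \<gamma> = descents \<gamma>'" using left[of \<gamma> \<delta>] left[of \<gamma>' \<delta>'] E w by metis
    moreover have "(+) m ` descents \<delta> = (+) m ` descents \<delta>'"
      using right[of \<gamma> \<delta>] right[of \<gamma>' \<delta>'] E w by metis
    then have "descents \<delta> = descents \<delta>'" by (simp add: inj_image_eq_iff)
    ultimately show ?thesis using w by (auto intro: composition_eqI)
  qed
  then show "((case p of (\<gamma>, \<delta>) \<Rightarrow> \<gamma> + \<delta>) = (case p' of (\<gamma>, \<delta>) \<Rightarrow> \<gamma> + \<delta>)) = (p = p')"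
    using p by auto
next
  fix p assume "p \<in> compositions m \<times> compositions n"
  then show "(case p of (\<gamma>, \<delta>) \<Rightarrow> \<gamma> + \<delta>) \<in> {\<beta> \<in> compositions (m + n). m \<in> descents \<beta>}"
    using assms by (auto simp: compositions_def weight_plus descents_plus)
next
  fix \<beta> assume \<beta>: "\<beta> \<in> {\<beta> \<in> compositions (m + n). m \<in> descents \<beta>}"
  \<comment> \<open>The preimage cuts \<beta> at \<open>m\<close>: the left piece keeps the descents
    below \<open>m\<close>, the right piece those above, moved down by \<open>m\<close>.\<close>
  obtain \<gamma> where \<gamma>: "weight \<gamma> = m" "descents \<gamma> = descents \<beta> \<inter> {1..<m}"
    by (rule composition_exists[of "descents \<beta> \<inter> {1..<m}" m]) auto
  obtain \<delta> where \<delta>: "weight \<delta> = n" "descents \<delta> = {i \<in> {1..<n}. m + i \<in> descents \<beta>}"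
    by (rule composition_exists[of "{i \<in> {1..<n}. m + i \<in> descents \<beta>}" n]) auto
  have "s \<in> (+) m ` descents \<delta>" if "s \<in> descents \<beta>" "m < s" for s
    using that \<beta> descents_subset[of \<beta>] \<delta>
    by (intro image_eqI[of _ _ "s - m"]) (auto simp: compositions_def)
  moreover have "1 \<le> s" if "s \<in> descents \<beta>" for s
    using that descents_subset[of \<beta>] by auto
  ultimately have "descents \<beta> = descents (\<gamma> + \<delta>)"
    using \<beta> \<gamma> \<delta> assms
    by (subst descents_plus) (auto simp: nat_neq_iff not_less le_less)
  then have "\<beta> = \<gamma> + \<delta>"
    using \<beta> \<gamma> \<delta> by (intro composition_eqI) (auto simp: weight_plus compositions_def)
  then show "\<exists>p\<in>compositions m \<times> compositions n. \<beta> = (case p of (\<gamma>, \<delta>) \<Rightarrow> \<gamma> + \<delta>)"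
    using \<gamma> \<delta> by (intro bexI[of _ "(\<gamma>, \<delta>)"]) (auto simp: compositions_def)
qed

text \<open>Apart from \<open>m\<close>, every position lies on one side of the cut and contributes
  to the corresponding factor. The position \<open>m\<close> is in the set and contributes
  \<open>w m = 1\<close>.\<close>

lemma h_coeff_split:
  assumes "0 < m" "0 < n" "S \<subseteq> {1..<m}" "T \<subseteq> {1..<n}" "w m = 1"
  shows "h_coeff (m + n) w (S \<union> insert m ((+) m ` T)) =
    h_coeff m w S * h_coeff n (\<lambda>i. w (m + i)) T"
proof -
  have fin: "finite S" "finite T" using assms by (auto intro: finite_subset)
  have "m \<notin> (+) m ` T" using assms by auto
  moreover have "S \<inter> insert m ((+) m ` T) = {}" using assms by fastforce
  ultimately have 1: "prod w (S \<union> insert m ((+) m ` T)) = prod w S * (\<Prod>i\<in>T. w (m + i))"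
    using fin assms by (simp add: prod.union_disjoint prod.reindex)
  have split: "{1..<m + n} - (S \<union> insert m ((+) m ` T)) = ({1..<m} - S) \<union> (+) m ` ({1..<n} - T)"
    (is "?L = ?R")
  proof (rule set_eqI)
    fix s
    consider "s < m" | "s = m" | i where "s = m + i" "1 \<le> i"
      by (metis One_nat_def Suc_leI less_imp_add_positive linorder_neqE_nat)
    then show "s \<in> ?L \<longleftrightarrow> s \<in> ?R"
      using assms(1-4) by cases auto
  qed
  have "({1..<m} - S) \<inter> (+) m ` ({1..<n} - T) = {}" by auto
  then have 2: "(\<Prod>i\<in>?L. 1 - w i) =
      (\<Prod>i\<in>{1..<m} - S. 1 - w i) * (\<Prod>i\<in>{1..<n} - T. 1 - w (m + i))"
    unfolding split by (simp add: prod.union_disjoint prod.reindex)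
  show ?thesis unfolding h_coeff_def 1 2 by (simp add: ac_simps)
qed

lemma ribbon_sum_mult:
  assumes "0 < m" "0 < n" "w m = 1"
  shows "ribbon_sum (m + n) w = ribbon_sum m w * ribbon_sum n (\<lambda>i. w (m + i))"
proof -
  let ?h = "\<lambda>\<beta>. Poly_Mapping.single \<beta> (h_coeff (m + n) w (descents \<beta>))"
  \<comment> \<open>Without a descent at \<open>m\<close> the coefficient contains the factor
    \<open>1 - w m = 0\<close>. The surviving basis elements are those that can be cut at
    \<open>m\<close>.\<close>
  have "h_coeff (m + n) w S = 0" if "m \<notin> S" for S
    unfolding h_coeff_def using that assms by auto
  then have "ribbon_sum (m + n) w = sum ?h {\<beta> \<in> compositions (m + n). m \<in> descents \<beta>}"
    unfolding ribbon_sum_expand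
    by (intro sum.mono_neutral_right) (auto simp: finite_compositions)
  also have "\<dots> = (\<Sum>(\<gamma>, \<delta>)\<in>compositions m \<times> compositions n. ?h (\<gamma> + \<delta>))"
    by (subst sum.reindex_bij_betw[OF bij_betw_plus_compositions[OF assms(1,2)], symmetric])
      (simp add: case_prod_unfold)
  also have "\<dots> = (\<Sum>(\<gamma>, \<delta>)\<in>compositions m \<times> compositions n.
      Poly_Mapping.single \<gamma> (h_coeff m w (descents \<gamma>)) *
      Poly_Mapping.single \<delta> (h_coeff n (\<lambda>i. w (m + i)) (descents \<delta>)))"
  proof (rule sum.cong, simp, clarify)
    fix \<gamma> \<delta> assume "\<gamma> \<in> compositions m" "\<delta> \<in> compositions n"
    then have *: "weight \<gamma> = m" "weight \<delta> = n" by (auto simp: compositions_def)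
    then have "h_coeff (m + n) w (descents (\<gamma> + \<delta>)) =
        h_coeff m w (descents \<gamma>) * h_coeff n (\<lambda>i. w (m + i)) (descents \<delta>)"
      using assms descents_subset[of \<gamma>] descents_subset[of \<delta>]
      by (simp only: descents_plus h_coeff_split)
    then show "?h (\<gamma> + \<delta>) = Poly_Mapping.single \<gamma> (h_coeff m w (descents \<gamma>)) *
        Poly_Mapping.single \<delta> (h_coeff n (\<lambda>i. w (m + i)) (descents \<delta>))"
      by (simp add: mult_single)
  qed
  also have "\<dots> = ribbon_sum m w * ribbon_sum n (\<lambda>i. w (m + i))"
    by (simp add: ribbon_sum_expand sum_product sum.cartesian_product)
  finally show ?thesis .
qed


section \<open>The factorization\<close>

text \<open>The number of descents is \<open>len \<beta> - 1\<close>, so \<open>i\<close> is counted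
  once per descent. A descent \<open>j\<close> contributes a further \<open>m - j\<close> through
  the reversed statistic.\<close>

lemma H_row_eq_ribbon_sum: "H_row m i = ribbon_sum m (\<lambda>j. q_var ^ (i + m - j))"
  unfolding H_row_def ribbon_sum_def
proof (rule sum.cong)
  fix \<beta> assume "\<beta> \<in> compositions m"
  then have w: "weight \<beta> = m" by (simp add: compositions_def)
  have "(len \<beta> - 1) * i + n_stat (reverse \<beta>) = (\<Sum>j\<in>descents \<beta>. i + (m - j))"
    by (simp add: n_stat_reverse w sum.distrib card_descents)
  also have "\<dots> = (\<Sum>j\<in>descents \<beta>. i + m - j)"
    using descents_subset[of \<beta>] w by (intro sum.cong) auto
  finally show "scale (q_var ^ ((len \<beta> - 1) * i + n_stat (reverse \<beta>))) (ribbon \<beta>) =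
      scale (\<Prod>j\<in>descents \<beta>. q_var ^ (i + m - j)) (ribbon \<beta>)"
    by (simp add: power_sum)
qed simp

section \<open>Specializing at t = 1\<close>

lemma specialize_t1_to_fract: "specialize_t1 (to_fract p) = to_fract [:poly p 1:]"
  using specialize_t1_Fract[of 1 p] by (simp add: to_fract_def one_pCons)

text \<open>Restricted to polynomials: the convention at poles destroys additivity in general, as
  the sum of \<open>t/(t-1)\<close> and \<open>-1/(t-1)\<close> shows.\<close>

lemma specialize_t1_add:
  "specialize_t1 (to_fract p + to_fract q) = specialize_t1 (to_fract p) + specialize_t1 (to_fract q)"
proof -
  have "[:poly (p + q) 1:] = [:poly p 1:] + [:poly q 1:]" by simp
  then show ?thesis by (simp only: specialize_t1_to_fract flip: to_fract_add)
qed

lemma to_fract_sum: "to_fract (sum f A) = (\<Sum>x\<in>A. to_fract (f x))"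
  by (induction A rule: infinite_finite_induct) auto

lemma specialize_t1_sum:
  "specialize_t1 (\<Sum>x\<in>A. to_fract (f x)) = (\<Sum>x\<in>A. specialize_t1 (to_fract (f x)))"
proof (induction A rule: infinite_finite_induct)
  case (insert x A)
  have "specialize_t1 (\<Sum>x\<in>insert x A. to_fract (f x)) =
      specialize_t1 (to_fract (f x) + to_fract (sum f A))"
    using insert.hyps by (simp add: to_fract_sum)
  also have "\<dots> = specialize_t1 (to_fract (f x)) + (\<Sum>x\<in>A. specialize_t1 (to_fract (f x)))"
    unfolding specialize_t1_add using insert.IH by (simp only: to_fract_sum)
  also have "\<dots> = (\<Sum>x\<in>insert x A. specialize_t1 (to_fract (f x)))"
    using insert.hyps by (rule sum.insert[symmetric])
  finally show ?case .
qed auto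

lemma to_fract_power: "to_fract p ^ k = to_fract (p ^ k)"
  by (induction k) auto

text \<open>Once the power of t becomes 1, the remaining q-exponent is a sum over the descents of
  \<beta> that are not descents of \<alpha>, so the coefficient is a product of weights over the
  descents of \<beta>.\<close>

lemma H_q1_eq_ribbon_sum:
  "H_q1 \<alpha> = ribbon_sum (weight \<alpha>)
    (\<lambda>i. if i \<in> descents \<alpha> then 1 else q_var ^ (weight \<alpha> - i))"
proof (rule poly_mapping_eqI)
  fix \<gamma>
  define a b where "a \<beta> = c_stat \<alpha> (complement \<beta>)"
    and "b \<beta> = c_stat (conjugate \<alpha>) (reverse \<beta>)" for \<beta>
  define r :: "composition \<Rightarrow> rat poly" where
    "r \<beta> = (if finer_eq \<beta> \<gamma> then (- 1) ^ card (descents \<beta> - descents \<gamma>) else 0)" for \<beta>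
  \<comment> \<open>The summands are exhibited as polynomials in t, with the q-power and the ribbon
    sign in the constant, so that specialization distributes over the sum.\<close>
  define f :: "composition \<Rightarrow> rat poly poly" where
    "f \<beta> = [:0, 1:] ^ a \<beta> * [:[:0, 1:] ^ b \<beta> * r \<beta>:]" for \<beta>
  have const_power: "[:p:] ^ k = [:p ^ k:]" for p :: "rat poly" and k
    by (induction k) (auto simp: one_pCons)
  have neg: "(- 1 :: ratfun) = to_fract [:- 1:]"
  proof -
    have "[:- 1:] = (- 1 :: rat poly poly)" by (simp add: one_pCons)
    then show ?thesis by simp
  qed
  have r: "Poly_Mapping.lookup (ribbon \<beta>) \<gamma> = to_fract [:r \<beta>:]" for \<beta>
    by (simp add: lookup_ribbon r_def neg to_fract_power const_power)
  have q: "q_var ^ k * to_fract [:c:] = to_fract [:[:0, 1:] ^ k * c:]" for k c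
    by (simp add: q_var_def to_fract_power const_power flip: to_fract_mult)
  have "Poly_Mapping.lookup (H_qt \<alpha>) \<gamma> = (\<Sum>\<beta>\<in>compositions (weight \<alpha>). to_fract (f \<beta>))"
    unfolding H_qt_def lookup_sum lookup_scale r a_def[symmetric] b_def[symmetric] mult.assoc q
    by (simp only: f_def t_var_def to_fract_power to_fract_mult)
  \<comment> \<open>\<open>Poly_Mapping.map\<close> acts on nonzero coefficients only, which agrees
    with applying \<open>specialize_t1\<close> everywhere because it sends 0 to 0.\<close>
  then have "Poly_Mapping.lookup (H_q1 \<alpha>) \<gamma> =
      (\<Sum>\<beta>\<in>compositions (weight \<alpha>). specialize_t1 (to_fract (f \<beta>)))"
    by (simp add: H_q1_def Poly_Mapping.map.rep_eq when_def specialize_t1_sum[symmetric])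
  also have "\<dots> = (\<Sum>\<beta>\<in>compositions (weight \<alpha>).
      q_var ^ b \<beta> * Poly_Mapping.lookup (ribbon \<beta>) \<gamma>)"
    by (simp add: specialize_t1_to_fract f_def r q)
  also have "\<dots> = (\<Sum>\<beta>\<in>compositions (weight \<alpha>).
      (\<Prod>i\<in>descents \<beta>. if i \<in> descents \<alpha> then 1 else q_var ^ (weight \<alpha> - i)) *
      Poly_Mapping.lookup (ribbon \<beta>) \<gamma>)"
  proof (rule sum.cong)
    fix \<beta> assume "\<beta> \<in> compositions (weight \<alpha>)"
    then have "b \<beta> = (\<Sum>i\<in>descents \<beta> - descents \<alpha>. weight \<alpha> - i)"
      by (simp add: b_def compositions_def c_stat_conjugate_reverse)
    then have "q_var ^ b \<beta> = (\<Prod>i\<in>descents \<beta> - descents \<alpha>. q_var ^ (weight \<alpha> - i))"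
      by (simp add: power_sum)
    \<comment> \<open>The added positions are descents of \<alpha> and carry the weight 1.\<close>
    also have "\<dots> = (\<Prod>i\<in>descents \<beta>. if i \<in> descents \<alpha> then 1 else q_var ^ (weight \<alpha> - i))"
      by (rule prod.mono_neutral_cong_left) auto
    finally show "q_var ^ b \<beta> * Poly_Mapping.lookup (ribbon \<beta>) \<gamma> =
        (\<Prod>i\<in>descents \<beta>. if i \<in> descents \<alpha> then 1 else q_var ^ (weight \<alpha> - i)) *
        Poly_Mapping.lookup (ribbon \<beta>) \<gamma>" by simp
  qed simp
  finally show "Poly_Mapping.lookup (H_q1 \<alpha>) \<gamma> = Poly_Mapping.lookup (ribbon_sum (weight \<alpha>)
      (\<lambda>i. if i \<in> descents \<alpha> then 1 else q_var ^ (weight \<alpha> - i))) \<gamma>"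
    by (simp add: ribbon_sum_def lookup_sum lookup_scale)
qed

text \<open>Induction on the list of parts, each step cutting after the first part. The weights left
  of that cut are those of a row whose parameter is the sum of the remaining parts.\<close>

lemma ribbon_sum_psums:
  assumes "\<forall>x\<in>set xs. 0 < x"
  shows "ribbon_sum (sum_list xs) (\<lambda>i. if i \<in> psums xs then 1 else q_var ^ (sum_list xs - i)) =
    prod_list (map (\<lambda>j. H_row (xs ! j) (\<Sum>i\<in>{j<..<length xs}. xs ! i)) [0..<length xs])"
  using assms
proof (induction xs)
  case (Cons x xs)
  let ?w = "\<lambda>i. if i \<in> psums (x # xs) then 1 else q_var ^ (sum_list (x # xs) - i)"
  have "(\<Sum>i\<in>{0<..<Suc (length xs)}. (x # xs) ! i) = (\<Sum>i<length xs. xs ! i)"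
    by (rule sum.reindex_bij_witness[of _ Suc "\<lambda>i. i - 1"]) auto
  then have head: "(\<Sum>i\<in>{0<..<Suc (length xs)}. (x # xs) ! i) = sum_list xs"
    by (simp add: sum_list_sum_nth atLeast0LessThan)
  have tail: "(\<Sum>i\<in>{Suc j<..<Suc (length xs)}. (x # xs) ! i) = (\<Sum>i\<in>{j<..<length xs}. xs ! i)" for j
    by (rule sum.reindex_bij_witness[of _ Suc "\<lambda>i. i - 1"]) auto
  have upt: "[0..<Suc (length xs)] = 0 # map Suc [0..<length xs]"
    by (simp add: upt_conv_Cons map_Suc_upt del: upt_Suc)
  have "prod_list (map (\<lambda>j. H_row ((x # xs) ! j) (\<Sum>i\<in>{j<..<length (x # xs)}. (x # xs) ! i))
      [0..<length (x # xs)]) = H_row x (sum_list xs) *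
      prod_list (map (\<lambda>j. H_row (xs ! j) (\<Sum>i\<in>{j<..<length xs}. xs ! i)) [0..<length xs])"
    by (simp only: length_Cons upt head tail comp_def list.map map_map prod_list.Cons
      nth_Cons_0 nth_Cons_Suc)
  also have "\<dots> = ribbon_sum x (\<lambda>j. q_var ^ (sum_list xs + x - j)) *
      ribbon_sum (sum_list xs) (\<lambda>i. if i \<in> psums xs then 1 else q_var ^ (sum_list xs - i))"
    using Cons by (simp add: H_row_eq_ribbon_sum)
  also have "\<dots> = ribbon_sum (sum_list (x # xs)) ?w"
  \<comment> \<open>A single part has no cut. The second factor is then \<open>ribbon_sum 0\<close>,
    which is 1.\<close>
  proof (cases "xs = []")
    case True
    then show ?thesis by (simp add: ribbon_sum_0 psums_single)
  next
    case False
    have pos: "0 < x" "0 < sum_list xs" using Cons.prems False by (cases xs; simp)+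
    have "?w x = 1" using False by (simp add: psums_Cons)
    then have "ribbon_sum (sum_list (x # xs)) ?w =
        ribbon_sum x ?w * ribbon_sum (sum_list xs) (\<lambda>i. ?w (x + i))"
      using ribbon_sum_mult[of x "sum_list xs" ?w] pos by simp
    \<comment> \<open>All descents of the whole list are at least \<open>x\<close>, so every
      position before \<open>x\<close> has its q-power as weight.\<close>
    also have "ribbon_sum x ?w = ribbon_sum x (\<lambda>j. q_var ^ (sum_list xs + x - j))"
      using False by (intro ribbon_sum_cong) (auto simp: psums_Cons add.commute)
    \<comment> \<open>Shifting by \<open>x\<close> lowers the total and the position alike, so the
      exponents beyond the cut are those of the tail alone.\<close>
    also have "ribbon_sum (sum_list xs) (\<lambda>i. ?w (x + i)) =
        ribbon_sum (sum_list xs) (\<lambda>i. if i \<in> psums xs then 1 else q_var ^ (sum_list xs - i))"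
      using False by (intro ribbon_sum_cong) (auto simp: psums_Cons)
    finally show ?thesis by simp
  qed
  finally show ?case by simp
qed (simp add: ribbon_sum_0)

theorem proposition16:
  fixes \<alpha> :: composition
  assumes "weight \<alpha> \<ge> 1"
  shows "H_q1 \<alpha> =
    prod_list (map (\<lambda>j. H_row (parts \<alpha> ! j) (\<Sum>i\<in>{j<..<len \<alpha>}. parts \<alpha> ! i)) [0..<len \<alpha>])"
  using ribbon_sum_psums[OF parts_pos, of \<alpha>]
  unfolding H_q1_eq_ribbon_sum descents_eq_psums len_def weight_def .

end
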